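(* Let $(S,\mathcal S)$ be a measurable space (an arbitrary non-empty set with a $\sigma$-algebra), $R$ a Markov kernel on $(S,\mathcal S)$ and $U_0$ a probability measure on $(S,\mathcal S)$. Let $(U_n)_{n\ge 0}$ be the urn model with colors indexed by $S$, replacement kernel $R$ and initial configuration $U_0$, and for $n\ge 0$ let $Z_n$ be the random color of the $(n+1)$-th draw. For $n\ge -1$ let $\mathcal T_n$ be the random recursive tree on the $n+2$ vertices $\{-1;0,1,\dots,n\}$ with root $-1$, and let $\mathcal T:=\bigcup_{n\ge -1}\mathcal T_n$. Let $\Delta\notin S$, $\hat S:=\{\Delta\}\cup S$, $\hat{\mathcal S}:=\mathcal S\cup\{A\cup\{\Delta\}: A\in\mathcal S\}$, and let $\hat R$ be the Markov kernel on $(\hat S,\hat{\mathcal S})$ determined by $$\hat R(\hat s,A):=\begin{cases}U_0(A) & \text{if } \hat s=\Delta,\\ R(\hat s,A) & \text{if } \hat s\neq\Delta,\end{cases}\qquad \hat s\in\hat S,\ A\in\mathcal S .$$ Let $(W_n)_{n\ge -1}$ be the branching Markov chain on $\mathcal T$ with transition kernel $\hat R$, starting at the root $-1$ at position $\Delta$. Then the two processes have the same law: $$(Z_n)_{n\ge 0}\stackrel{d}{=}(W_n)_{n\ge 0}.$$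
   Context: A Markov kernel $R$ on $(S,\mathcal S)$ is a map $R:S\times\mathcal S\to[0,1]$ such that $R(s,\cdot)$ is a probability measure for every $s\in S$ and $s\mapsto R(s,A)$ is measurable for every $A\in\mathcal S$. Urn model: given the probability measure $U_0$ (non-random), the random finite measures $U_n$ on $(S,\mathcal S)$ and random colors $Z_n\in S$ are defined recursively for $n\ge 0$ by: conditionally on the past (the previous draws $Z_0,\dots,Z_{n-1}$, hence $U_0,\dots,U_n$), $Z_n$ has distribution $U_n/(n+1)$; and $U_{n+1}(A)=U_n(A)+R(Z_n,A)$ for $A\in\mathcal S$. (Thus $U_n(S)=n+1$.) Random recursive tree: $\mathcal T_{-1}$ consists of the root $-1$ only; for $n\ge 0$, $\mathcal T_n$ is obtained from $\mathcal T_{n-1}$ by attaching vertex $n$ as a child of a vertex $D_n$ which is uniformly distributed on $\{-1,0,\dots,n-1\}$, the $(D_n)_{n\ge0}$ being independent. Branching Markov chain on $\mathcal T$ with kernel $\hat R$ started at $\Delta$: $W_{-1}=\Delta$ and, for every $n\ge 0$, conditionally on $\mathcal T$ and $W_{-1},W_0,\dots,W_{n-1}$, the variable $W_n$ has distribution $\hat R(W_{D_n},\cdot)$, where $D_n$ is the parent of $n$. *)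

theory Defs
  imports "HOL-Probability.Probability"
begin

definition markov_kernel :: "'a measure \<Rightarrow> ('a \<Rightarrow> 'a measure) \<Rightarrow> bool" where
  "markov_kernel M R \<longleftrightarrow>
     (\<forall>s\<in>space M. prob_space (R s) \<and> sets (R s) = sets M) \<and>
     (\<forall>A\<in>sets M. (\<lambda>s. measure (R s) A) \<in> borel_measurable M)"

lemma markov_kernel_iff_prob_algebra:
  "markov_kernel M R \<longleftrightarrow> R \<in> M \<rightarrow>\<^sub>M prob_algebra M"
proof
  assume K: "markov_kernel M R"
  have "R \<in> M \<rightarrow>\<^sub>M subprob_algebra M"
  proof (rule measurable_subprob_algebra)
    fix s assume "s \<in> space M"
    then show "subprob_space (R s)" "sets (R s) = sets M"
      using K by (auto simp: markov_kernel_def intro: prob_space_imp_subprob_space)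
  next
    fix A assume A: "A \<in> sets M"
    have "(\<lambda>s. ennreal (measure (R s) A)) \<in> borel_measurable M"
      using K A by (auto simp: markov_kernel_def)
    then show "(\<lambda>s. emeasure (R s) A) \<in> borel_measurable M"
      by (rule measurable_cong[THEN iffD1, rotated])
         (use K in \<open>auto simp: markov_kernel_def prob_space_def finite_measure.emeasure_eq_measure\<close>)
  qed
  then show "R \<in> M \<rightarrow>\<^sub>M prob_algebra M"
    unfolding prob_algebra_def
    by (rule measurable_restrict_space2[rotated])
       (use K in \<open>auto simp: markov_kernel_def\<close>)
next
  assume R: "R \<in> M \<rightarrow>\<^sub>M prob_algebra M"
  then have "\<forall>s\<in>space M. prob_space (R s) \<and> sets (R s) = sets M"
    by (auto dest!: measurable_space simp: space_prob_algebra)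
  moreover have "(\<lambda>s. measure (R s) A) \<in> borel_measurable M" if "A \<in> sets M" for A
    using measurable_compose[OF measurable_prob_algebraD[OF R] measurable_measure_subprob_algebra[OF that]] .
  ultimately show "markov_kernel M R"
    by (simp add: markov_kernel_def)
qed

text \<open>
  The extended colour space: \<open>\<Delta>\<close> is \<^term>\<open>None\<close>, and \<open>S\<close> is embedded by \<^term>\<open>Some\<close>, so that
  \<open>\<Delta> \<notin> S\<close> holds for every measurable space, including one whose carrier is the whole type.
\<close>

definition hat_space :: "'a measure \<Rightarrow> 'a option measure" where
  "hat_space M = sigma (insert None (Some ` space M))
     ((\<lambda>A. Some ` A) ` sets M \<union> (\<lambda>A. insert None (Some ` A)) ` sets M)"

lemma space_hat_space: "space (hat_space M) = insert None (Some ` space M)"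
  unfolding hat_space_def
  by (rule space_measure_of) (auto dest: sets.sets_into_space)

lemma sets_hat_space:
  "sets (hat_space M) =
     (\<lambda>A. Some ` A) ` sets M \<union> (\<lambda>A. insert None (Some ` A)) ` sets M"
    (is "_ = ?G")
proof -
  let ?O = "insert None (Some ` space M)"
  have G: "B \<in> ?G \<longleftrightarrow> B \<subseteq> ?O \<and> Some -` B \<in> sets M" for B
  proof
    assume "B \<in> ?G"
    then show "B \<subseteq> ?O \<and> Some -` B \<in> sets M"
    proof
      assume "B \<in> (\<lambda>A. Some ` A) ` sets M"
      then obtain A where A: "A \<in> sets M" "B = Some ` A" by auto
      then have "Some -` B = A" by auto
      with A show ?thesis by (auto dest: sets.sets_into_space)
    next
      assume "B \<in> (\<lambda>A. insert None (Some ` A)) ` sets M"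
      then obtain A where A: "A \<in> sets M" "B = insert None (Some ` A)" by auto
      then have "Some -` B = A" by auto
      with A show ?thesis by (auto dest: sets.sets_into_space)
    qed
  next
    assume B: "B \<subseteq> ?O \<and> Some -` B \<in> sets M"
    show "B \<in> ?G"
    proof (cases "None \<in> B")
      case True
      have "B = insert None (Some ` (Some -` B))"
      proof (rule set_eqI)
        fix x show "x \<in> B \<longleftrightarrow> x \<in> insert None (Some ` (Some -` B))"
          using True by (cases x) auto
      qed
      then show ?thesis using B by blast
    next
      case False
      have "B = Some ` (Some -` B)"
      proof (rule set_eqI)
        fix x show "x \<in> B \<longleftrightarrow> x \<in> Some ` (Some -` B)"
          using False by (cases x) auto
      qed
      then show ?thesis using B by blast
    qed
  qed
  have eq: "?G = {B. B \<subseteq> ?O \<and> Some -` B \<in> sets M}"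
    by (rule set_eqI) (simp only: G mem_Collect_eq)
  have "sigma_algebra ?O {B. B \<subseteq> ?O \<and> Some -` B \<in> sets M}"
    unfolding sigma_algebra_iff2
  proof (intro conjI ballI allI impI)
    fix B assume "B \<in> {B. B \<subseteq> ?O \<and> Some -` B \<in> sets M}"
    moreover have "Some -` (?O - B) = space M - Some -` B" by auto
    ultimately show "?O - B \<in> {B. B \<subseteq> ?O \<and> Some -` B \<in> sets M}"
      by (simp add: sets.compl_sets)
  next
    fix B :: "nat \<Rightarrow> 'a option set"
    assume "range B \<subseteq> {B. B \<subseteq> ?O \<and> Some -` B \<in> sets M}"
    then have B: "B i \<subseteq> ?O" "Some -` B i \<in> sets M" for i by auto
    then have "(\<Union>i. Some -` B i) \<in> sets M" by (intro sets.countable_nat_UN) auto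
    moreover have "(\<Union>i. B i) \<subseteq> ?O" using B(1) by (rule UN_least)
    ultimately show "(\<Union>i. B i) \<in> {B. B \<subseteq> ?O \<and> Some -` B \<in> sets M}"
      by (simp add: vimage_UN)
  qed auto
  then have "sigma_algebra ?O ?G" by (simp only: eq)
  then show ?thesis
    unfolding hat_space_def by (rule sigma_algebra.sets_measure_of_eq)
qed

lemma Some_vimage_image: "Some -` (Some ` A) = A" by auto

lemma Some_vimage_insert: "Some -` (insert None (Some ` A)) = A" by auto

lemma measurable_Some_hat_space [measurable]: "Some \<in> M \<rightarrow>\<^sub>M hat_space M"
proof (rule measurableI)
  fix B assume "B \<in> sets (hat_space M)"
  then have "Some -` B \<in> sets M"
    by (auto simp: sets_hat_space Some_vimage_image Some_vimage_insert)
  then show "Some -` B \<inter> space M \<in> sets M" by auto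
qed (simp add: space_hat_space)

text \<open>A measure on \<open>S\<close> is regarded as a measure on the extended space by push-forward along
  \<^term>\<open>Some\<close>; it gives mass 0 to \<open>{\<Delta>}\<close>.\<close>

definition hat_kernel ::
    "'a measure \<Rightarrow> 'a measure \<Rightarrow> ('a \<Rightarrow> 'a measure) \<Rightarrow> 'a option \<Rightarrow> 'a option measure" where
  "hat_kernel M U0 R x =
     (case x of None \<Rightarrow> distr U0 (hat_space M) Some | Some s \<Rightarrow> distr (R s) (hat_space M) Some)"

lemma emeasure_distr_Some:
  assumes "sets N = sets M" "A \<in> sets M"
  shows "emeasure (distr N (hat_space M) Some) (Some ` A) = emeasure N A"
proof -
  have "Some -` (Some ` A) \<inter> space N = A"
    using assms sets.sets_into_space[of A M] sets_eq_imp_space_eq[OF assms(1)] by auto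
  moreover have "Some \<in> N \<rightarrow>\<^sub>M hat_space M"
    using measurable_Some_hat_space[of M] measurable_cong_sets[OF assms(1) refl] by blast
  ultimately show ?thesis
    using assms by (subst emeasure_distr) (auto simp: sets_hat_space)
qed

lemma emeasure_hat_kernel:
  assumes "sets U0 = sets M" "markov_kernel M R" "A \<in> sets M"
  shows "emeasure (hat_kernel M U0 R None) (Some ` A) = emeasure U0 A"
    and "s \<in> space M \<Longrightarrow> emeasure (hat_kernel M U0 R (Some s)) (Some ` A) = emeasure (R s) A"
  using assms by (auto simp: hat_kernel_def emeasure_distr_Some markov_kernel_def)

lemma markov_kernel_hat_kernel:
  assumes U0: "prob_space U0" "sets U0 = sets M" and R: "markov_kernel M R"
  shows "markov_kernel (hat_space M) (hat_kernel M U0 R)"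
proof -
  have m: "Some \<in> N \<rightarrow>\<^sub>M hat_space M" if "sets N = sets M" for N
    using measurable_Some_hat_space[of M] measurable_cong_sets[OF that refl] by blast
  have p: "prob_space (hat_kernel M U0 R x)" "sets (hat_kernel M U0 R x) = sets (hat_space M)"
    if "x \<in> space (hat_space M)" for x
    using that U0 R
    by (auto simp: hat_kernel_def space_hat_space markov_kernel_def
             intro!: prob_space.prob_space_distr m)
  have "(\<lambda>x. measure (hat_kernel M U0 R x) B) \<in> borel_measurable (hat_space M)"
    if B: "B \<in> sets (hat_space M)" for B
  proof (rule measurableI)
    fix C :: "real set" assume C: "C \<in> sets borel"
    let ?f = "\<lambda>x. measure (hat_kernel M U0 R x) B"
    have SB: "Some -` B \<in> sets M" 
      using B by (auto simp: sets_hat_space Some_vimage_image Some_vimage_insert)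
    have f: "?f (Some s) = measure (R s) (Some -` B)" if "s \<in> space M" for s
    proof -
      have "sets (R s) = sets M" using R that by (auto simp: markov_kernel_def)
      then show ?thesis
        using B SB sets.sets_into_space[OF SB] sets_eq_imp_space_eq[of "R s" M]
        by (simp add: hat_kernel_def measure_distr m Int_absorb2)
    qed
    let ?A = "(\<lambda>s. measure (R s) (Some -` B)) -` C \<inter> space M"
    have A: "?A \<in> sets M"
      using R SB C by (auto simp: markov_kernel_def intro: measurable_sets)
    have "?f -` C \<inter> space (hat_space M) =
        (if ?f None \<in> C then insert None (Some ` ?A) else Some ` ?A)"
      using f by (auto simp: space_hat_space)
    then show "?f -` C \<inter> space (hat_space M) \<in> sets (hat_space M)"
      using A by (auto simp: sets_hat_space)
  qed simp
  with p show ?thesis by (simp add: markov_kernel_def)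
qed

definition has_cond_law ::
    "'w measure \<Rightarrow> 'w measure \<Rightarrow> 'a measure \<Rightarrow> ('w \<Rightarrow> 'a) \<Rightarrow> ('w \<Rightarrow> 'a measure) \<Rightarrow> bool" where
  "has_cond_law P F M X \<kappa> \<longleftrightarrow>
     X \<in> P \<rightarrow>\<^sub>M M \<and> subalgebra P F \<and>
     (\<forall>A\<in>sets M. AE \<omega> in P.
        real_cond_exp P F (indicator (X -` A \<inter> space P)) \<omega> = measure (\<kappa> \<omega>) A)"

text \<open>\<open>past_draws P M Z n\<close> is the \<open>\<sigma>\<close>-algebra generated by \<open>Z 0, \<dots>, Z (n - 1)\<close>.\<close>

definition past_draws ::
    "'w measure \<Rightarrow> 'a measure \<Rightarrow> (nat \<Rightarrow> 'w \<Rightarrow> 'a) \<Rightarrow> nat \<Rightarrow> 'w measure" where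
  "past_draws P M Z n =
     vimage_algebra (space P) (\<lambda>\<omega>. \<lambda>k\<in>{..<n}. Z k \<omega>) (Pi\<^sub>M {..<n} (\<lambda>_. M))"

definition urn_model ::
    "'w measure \<Rightarrow> 'a measure \<Rightarrow> ('a \<Rightarrow> 'a measure) \<Rightarrow> 'a measure \<Rightarrow>
     (nat \<Rightarrow> 'w \<Rightarrow> 'a measure) \<Rightarrow> (nat \<Rightarrow> 'w \<Rightarrow> 'a) \<Rightarrow> bool" where
  "urn_model P M R U0 U Z \<longleftrightarrow>
     prob_space P \<and>
     (\<forall>\<omega>\<in>space P. U 0 \<omega> = U0) \<and>
     (\<forall>n. \<forall>\<omega>\<in>space P. sets (U n \<omega>) = sets M) \<and>
     (\<forall>n. \<forall>\<omega>\<in>space P. \<forall>A\<in>sets M.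
        emeasure (U (Suc n) \<omega>) A = emeasure (U n \<omega>) A + emeasure (R (Z n \<omega>)) A) \<and>
     (\<forall>n. has_cond_law P (past_draws P M Z n) M (Z n)
            (\<lambda>\<omega>. scale_measure (ennreal (1 / (real n + 1))) (U n \<omega>)))"

lemma urn_model_total_mass:
  assumes R: "markov_kernel M R" and U0: "prob_space U0" "sets U0 = sets M"
    and urn: "urn_model P M R U0 U Z" and \<omega>: "\<omega> \<in> space P"
  shows "emeasure (U n \<omega>) (space M) = of_nat (n + 1)"
proof (induction n)
  case 0
  then show ?case
    using U0 urn \<omega> prob_space.emeasure_space_1[of U0] sets_eq_imp_space_eq[of U0 M]
    by (simp add: urn_model_def)
next
  case (Suc n)
  have Z: "Z n \<omega> \<in> space M"
    using urn \<omega> by (auto simp: urn_model_def has_cond_law_def dest: measurable_space)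
  then have "prob_space (R (Z n \<omega>))" "sets (R (Z n \<omega>)) = sets M"
    using R by (auto simp: markov_kernel_def)
  then have "emeasure (R (Z n \<omega>)) (space M) = 1"
    using prob_space.emeasure_space_1[of "R (Z n \<omega>)"] sets_eq_imp_space_eq[of "R (Z n \<omega>)" M] by simp
  moreover have "emeasure (U (Suc n) \<omega>) (space M) =
      emeasure (U n \<omega>) (space M) + emeasure (R (Z n \<omega>)) (space M)"
    using urn \<omega> by (simp add: urn_model_def)
  ultimately show ?case using Suc by (simp add: add.commute)
qed

text \<open>The random recursive tree is given by its parent map: \<open>D n\<close> is the parent of vertex \<open>n\<close>, so
  \<open>\<T>\<^sub>n\<close> has vertices \<open>{-1..n}\<close> and edges \<open>{D k, k}\<close> for \<open>0 \<le> k \<le> n\<close>, and conditioning on the tree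
  is conditioning on the whole sequence \<open>D\<close>.\<close>

definition random_recursive_tree :: "'w measure \<Rightarrow> (nat \<Rightarrow> 'w \<Rightarrow> int) \<Rightarrow> bool" where
  "random_recursive_tree Q D \<longleftrightarrow>
     prob_space Q \<and>
     prob_space.indep_vars Q (\<lambda>n. count_space {-1..<int n}) D UNIV \<and>
     (\<forall>n. distr Q (count_space {-1..<int n}) (D n) = uniform_count_measure {-1..<int n})"

text \<open>\<open>tree_and_past Q N D W n\<close> is the \<open>\<sigma>\<close>-algebra generated by the whole tree and
  \<open>W (-1), W 0, \<dots>, W (n - 1)\<close>.\<close>

definition tree_and_past ::
    "'w measure \<Rightarrow> 'b measure \<Rightarrow> (nat \<Rightarrow> 'w \<Rightarrow> int) \<Rightarrow> (int \<Rightarrow> 'w \<Rightarrow> 'b) \<Rightarrow> nat \<Rightarrow> 'w measure" where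
  "tree_and_past Q N D W n =
     vimage_algebra (space Q) (\<lambda>\<omega>. (\<lambda>k. D k \<omega>, \<lambda>j\<in>{-1..<int n}. W j \<omega>))
       (Pi\<^sub>M UNIV (\<lambda>k. count_space {-1..<int k}) \<Otimes>\<^sub>M Pi\<^sub>M {-1..<int n} (\<lambda>_. N))"

definition branching_markov_chain ::
    "'w measure \<Rightarrow> 'b measure \<Rightarrow> ('b \<Rightarrow> 'b measure) \<Rightarrow> 'b \<Rightarrow>
     (nat \<Rightarrow> 'w \<Rightarrow> int) \<Rightarrow> (int \<Rightarrow> 'w \<Rightarrow> 'b) \<Rightarrow> bool" where
  "branching_markov_chain Q N K x0 D W \<longleftrightarrow>
     prob_space Q \<and>
     (\<forall>\<omega>\<in>space Q. W (-1) \<omega> = x0) \<and>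
     (\<forall>n. has_cond_law Q (tree_and_past Q N D W n) N (W (int n)) (\<lambda>\<omega>. K (W (D n \<omega>) \<omega>)))"

end

theory Submission
  imports Defs
begin

text \<open>
  Both sequences, extended by \<open>\<Delta>\<close> at time \<open>-1\<close>, have the same one-step predictive law: given the
  values \<open>v\<close> at times \<open>-1, \<dots>, n - 1\<close>, the value at time \<open>n\<close> has law
  \<open>1/(n+1) \<Sum>\<^sub>j K(v\<^sub>j, \<cdot>)\<close>, where \<open>K\<close> is the extended kernel and \<open>j\<close> ranges over \<open>{-1..<n}\<close>.
  For the urn this is the normalised composition of \<open>U n\<close>. For the branching chain one conditions
  first on the tree; the parent \<open>D n\<close> is uniform and independent of the values before
  time \<open>n\<close>, so averaging over it gives the same mixture. Predictive laws determine the
  finite-dimensional distributions.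
\<close>

section \<open>Histories and one-step predictive laws\<close>

abbreviation hist_space :: "'b measure \<Rightarrow> nat \<Rightarrow> (int \<Rightarrow> 'b) measure" where
  "hist_space N n \<equiv> Pi\<^sub>M {-1..<int n} (\<lambda>_. N)"

text \<open>Restricting to indices below \<open>n\<close> makes the history extensional, hence a
  point of the product space. The index -1 is kept, so that the initial state \<Delta> is part of
  every history.\<close>

definition hist :: "(int \<Rightarrow> 'w \<Rightarrow> 'b) \<Rightarrow> nat \<Rightarrow> 'w \<Rightarrow> int \<Rightarrow> 'b" where
  "hist V n \<omega> = (\<lambda>j\<in>{-1..<int n}. V j \<omega>)"

definition mixture :: "('b \<Rightarrow> 'b measure) \<Rightarrow> nat \<Rightarrow> 'b set \<Rightarrow> (int \<Rightarrow> 'b) \<Rightarrow> ennreal" where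
  "mixture K n A v = ennreal (1 / (real n + 1)) * (\<Sum>j\<in>{-1..<int n}. emeasure (K (v j)) A)"

text \<open>The defining property of a conditional law, tested on events of the history, with no
  conditional expectation left. The predictive law sees the sample point only through the history,
  so processes on different probability spaces become comparable.\<close>

definition mixture_chain ::
    "'w measure \<Rightarrow> 'b measure \<Rightarrow> ('b \<Rightarrow> 'b measure) \<Rightarrow> (int \<Rightarrow> 'w \<Rightarrow> 'b) \<Rightarrow> bool" where
  "mixture_chain P N K V \<longleftrightarrow>
     (\<forall>n. \<forall>E\<in>sets (hist_space N n). \<forall>A\<in>sets N.
        emeasure P {\<omega>\<in>space P. hist V n \<omega> \<in> E \<and> V (int n) \<omega> \<in> A} =
        (\<integral>\<^sup>+\<omega>. indicator E (hist V n \<omega>) * mixture K n A (hist V n \<omega>) \<partial>P))"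

lemma hist_Suc: "hist V (Suc n) \<omega> = (hist V n \<omega>)(int n := V (int n) \<omega>)"
  by (auto simp: hist_def fun_eq_iff)

lemma hist_nth: "j \<in> {-1..<int n} \<Longrightarrow> hist V n \<omega> j = V j \<omega>"
  by (simp add: hist_def)

lemma measurable_hist:
  assumes "\<And>j. - 1 \<le> j \<Longrightarrow> V j \<in> P \<rightarrow>\<^sub>M N"
  shows "hist V n \<in> P \<rightarrow>\<^sub>M hist_space N n"
  unfolding hist_def by (rule measurable_restrict) (use assms in auto)

lemma measurable_hist_update:
  "(\<lambda>x. (fst x)(int n := snd x)) \<in> hist_space N n \<Otimes>\<^sub>M N \<rightarrow>\<^sub>M hist_space N (Suc n)"
proof (rule measurable_PiM_single')
  fix i assume i: "i \<in> {-1..<int (Suc n)}"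
  show "(\<lambda>x. ((fst x)(int n := snd x)) i) \<in> hist_space N n \<Otimes>\<^sub>M N \<rightarrow>\<^sub>M N"
  proof (cases "i = int n")
    case False
    then have "i \<in> {-1..<int n}" using i by auto
    then show ?thesis using False
      by (auto intro: measurable_compose[OF measurable_fst measurable_component_singleton])
  qed auto
next
  show "(\<lambda>x. (fst x)(int n := snd x)) \<in> space (hist_space N n \<Otimes>\<^sub>M N) \<rightarrow>
      {-1..<int (Suc n)} \<rightarrow>\<^sub>E space N"
    by (auto simp: space_pair_measure space_PiM PiE_iff extensional_def)
qed

lemma measurable_emeasure_prob_kernel:
  assumes "K \<in> N \<rightarrow>\<^sub>M prob_algebra N" "A \<in> sets N"
  shows "(\<lambda>x. emeasure (K x) A) \<in> borel_measurable N"
  using measurable_compose[OF measurable_prob_algebraD[OF assms(1)]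
      measurable_emeasure_subprob_algebra[OF assms(2)]] .

lemma measurable_mixture:
  assumes "K \<in> N \<rightarrow>\<^sub>M prob_algebra N" "A \<in> sets N"
  shows "mixture K n A \<in> borel_measurable (hist_space N n)"
proof -
  have [measurable]: "(\<lambda>v. emeasure (K (v j)) A) \<in> borel_measurable (hist_space N n)"
    if "j \<in> {-1..<int n}" for j
    by (rule measurable_compose[OF measurable_component_singleton[OF that]
          measurable_emeasure_prob_kernel[OF assms]])
  show ?thesis unfolding mixture_def by measurable
qed

section \<open>Predictive laws determine the law of the sequence\<close>

text \<open>Rectangles are stable under intersection and generate the product \<sigma>-algebra. The
  whole space is itself a rectangle of finite measure, so a constant exhausting sequence
  suffices.\<close>

lemma finite_measure_pair_eqI:
  assumes "finite_measure \<mu>" and \<mu>: "sets \<mu> = sets (L \<Otimes>\<^sub>M N)" and \<nu>: "sets \<nu> = sets (L \<Otimes>\<^sub>M N)"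
    and eq: "\<And>E A. E \<in> sets L \<Longrightarrow> A \<in> sets N \<Longrightarrow> emeasure \<mu> (E \<times> A) = emeasure \<nu> (E \<times> A)"
  shows "\<mu> = \<nu>"
proof (rule measure_eqI_generator_eq[OF Int_stable_pair_measure_generator[of L N] pair_measure_closed])
  show "range (\<lambda>_::nat. space L \<times> space N) \<subseteq> {a \<times> b |a b. a \<in> sets L \<and> b \<in> sets N}"
    by auto
  show "emeasure \<mu> (space L \<times> space N) \<noteq> \<infinity>" for i :: nat
    using assms(1) by (simp add: finite_measure.emeasure_finite)
qed (use \<mu> \<nu> eq in \<open>auto simp: sets_pair_measure\<close>)

text \<open>By change of variables, the mass of a rectangle is an integral against the law of
  \<open>Y\<close> or \<open>Y'\<close>, with the same integrand on both sides. Finite base measures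
  are allowed because the lemma is later applied to restrictions and multiples of
  \<open>Q\<close>.\<close>

lemma distr_extend_eq:
  assumes "finite_measure P"
    and [measurable]: "Y \<in> P \<rightarrow>\<^sub>M L" "X \<in> P \<rightarrow>\<^sub>M N" "Y' \<in> Q \<rightarrow>\<^sub>M L" "X' \<in> Q \<rightarrow>\<^sub>M N"
    and k[measurable]: "\<And>A. A \<in> sets N \<Longrightarrow> k A \<in> borel_measurable L"
    and P: "\<And>E A. E \<in> sets L \<Longrightarrow> A \<in> sets N \<Longrightarrow>
      emeasure P {\<omega>\<in>space P. Y \<omega> \<in> E \<and> X \<omega> \<in> A} = (\<integral>\<^sup>+\<omega>. indicator E (Y \<omega>) * k A (Y \<omega>) \<partial>P)"
    and Q: "\<And>E A. E \<in> sets L \<Longrightarrow> A \<in> sets N \<Longrightarrow>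
      emeasure Q {\<omega>\<in>space Q. Y' \<omega> \<in> E \<and> X' \<omega> \<in> A} = (\<integral>\<^sup>+\<omega>. indicator E (Y' \<omega>) * k A (Y' \<omega>) \<partial>Q)"
    and eq: "distr P L Y = distr Q L Y'"
  shows "distr P (L \<Otimes>\<^sub>M N) (\<lambda>\<omega>. (Y \<omega>, X \<omega>)) = distr Q (L \<Otimes>\<^sub>M N) (\<lambda>\<omega>. (Y' \<omega>, X' \<omega>))"
proof (rule finite_measure_pair_eqI)
  show "finite_measure (distr P (L \<Otimes>\<^sub>M N) (\<lambda>\<omega>. (Y \<omega>, X \<omega>)))"
    by (rule finite_measure.finite_measure_distr[OF assms(1)]) measurable
  fix E A assume [measurable]: "E \<in> sets L" "A \<in> sets N"
  have "emeasure (distr P (L \<Otimes>\<^sub>M N) (\<lambda>\<omega>. (Y \<omega>, X \<omega>))) (E \<times> A) =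
      emeasure P {\<omega>\<in>space P. Y \<omega> \<in> E \<and> X \<omega> \<in> A}"
    by (subst emeasure_distr) (auto intro!: arg_cong[where f="emeasure P"])
  also have "\<dots> = (\<integral>\<^sup>+y. indicator E y * k A y \<partial>distr P L Y)"
    by (subst nn_integral_distr) (simp_all add: P)
  also have "\<dots> = (\<integral>\<^sup>+y. indicator E y * k A y \<partial>distr Q L Y')"
    by (simp add: eq)
  also have "\<dots> = emeasure Q {\<omega>\<in>space Q. Y' \<omega> \<in> E \<and> X' \<omega> \<in> A}"
    by (subst nn_integral_distr) (simp_all add: Q)
  also have "\<dots> = emeasure (distr Q (L \<Otimes>\<^sub>M N) (\<lambda>\<omega>. (Y' \<omega>, X' \<omega>))) (E \<times> A)"
    by (subst emeasure_distr) (auto intro!: arg_cong[where f="emeasure Q"])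
  finally show "emeasure (distr P (L \<Otimes>\<^sub>M N) (\<lambda>\<omega>. (Y \<omega>, X \<omega>))) (E \<times> A) =
      emeasure (distr Q (L \<Otimes>\<^sub>M N) (\<lambda>\<omega>. (Y' \<omega>, X' \<omega>))) (E \<times> A)" .
qed simp_all

text \<open>Induction on \<open>n\<close>: the start \<open>r\<close> is shared, and
  \<open>mixture K n\<close> is one and the same function of the history for both processes, so
  \<open>distr_extend_eq\<close> adds one more state.\<close>

lemma mixture_chain_distr_hist_eq:
  assumes K: "K \<in> N \<rightarrow>\<^sub>M prob_algebra N" and "prob_space P" "prob_space Q"
    and V: "\<And>j. - 1 \<le> j \<Longrightarrow> V j \<in> P \<rightarrow>\<^sub>M N" "\<And>j. - 1 \<le> j \<Longrightarrow> V' j \<in> Q \<rightarrow>\<^sub>M N"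
    and x0: "\<And>\<omega>. \<omega> \<in> space P \<Longrightarrow> V (-1) \<omega> = r" "\<And>\<omega>. \<omega> \<in> space Q \<Longrightarrow> V' (-1) \<omega> = r"
    and chain: "mixture_chain P N K V" "mixture_chain Q N K V'"
  shows "distr P (hist_space N n) (hist V n) = distr Q (hist_space N n) (hist V' n)"
proof (induction n)
  case 0
  interpret P: prob_space P by fact
  interpret Q: prob_space Q by fact
  let ?c = "\<lambda>j\<in>{-1..<int 0}. r"
  \<comment> \<open>A probability space is not empty, and any sample point exhibits \<open>r\<close>
    as a value of a measurable map into \<open>N\<close>.\<close>
  obtain \<omega> where "\<omega> \<in> space P" using P.not_empty by auto
  then have "r \<in> space N" using measurable_space[OF V(1)[of "-1"]] x0(1) by force
  then have c: "?c \<in> space (hist_space N 0)" by (auto simp: space_PiM)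
  have I: "{-1..<int 0} = {-1}" by auto
  \<comment> \<open>The history at \<open>n = 0\<close> has the single index -1, so it is constant
    and both laws are the point mass at \<open>?c\<close>.\<close>
  have "distr P (hist_space N 0) (hist V 0) = distr P (hist_space N 0) (\<lambda>_. ?c)"
    by (rule distr_cong) (simp_all only: hist_def I, auto simp: x0)
  moreover have "distr Q (hist_space N 0) (hist V' 0) = distr Q (hist_space N 0) (\<lambda>_. ?c)"
    by (rule distr_cong) (simp_all only: hist_def I, auto simp: x0)
  ultimately show ?case
    using P.distr_const[OF c] Q.distr_const[OF c] by simp
next
  case (Suc n)
  note m[measurable] = measurable_hist[of V P N n, OF V(1)] measurable_hist[of V' Q N n, OF V(2)]
    and V[of "int n", simplified, measurable]
  let ?u = "\<lambda>x. (fst x)(int n := snd x)"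
  have "distr P (hist_space N n \<Otimes>\<^sub>M N) (\<lambda>\<omega>. (hist V n \<omega>, V (int n) \<omega>)) =
      distr Q (hist_space N n \<Otimes>\<^sub>M N) (\<lambda>\<omega>. (hist V' n \<omega>, V' (int n) \<omega>))"
    using chain Suc
    by (intro distr_extend_eq[where k="mixture K n"] measurable_mixture[OF K] m)
       (use \<open>prob_space P\<close> V in \<open>auto simp: mixture_chain_def prob_space_def\<close>)
  moreover have "distr P (hist_space N (Suc n)) (hist V (Suc n)) =
      distr (distr P (hist_space N n \<Otimes>\<^sub>M N) (\<lambda>\<omega>. (hist V n \<omega>, V (int n) \<omega>)))
        (hist_space N (Suc n)) ?u"
    unfolding hist_Suc[abs_def]
    by (subst distr_distr[OF measurable_hist_update]) (measurable, simp add: comp_def)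
  moreover have "distr Q (hist_space N (Suc n)) (hist V' (Suc n)) =
      distr (distr Q (hist_space N n \<Otimes>\<^sub>M N) (\<lambda>\<omega>. (hist V' n \<omega>, V' (int n) \<omega>)))
        (hist_space N (Suc n)) ?u"
    unfolding hist_Suc[abs_def]
    by (subst distr_distr[OF measurable_hist_update]) (measurable, simp add: comp_def)
  ultimately show ?case by metis
qed

text \<open>A finite measure on the sequence space is determined by finite-dimensional cylinders,
  and each cylinder is an event of a long enough history. The coordinate -1 is dropped here.\<close>

lemma distr_sequence_eqI:
  assumes P: "finite_measure P"
    and V: "\<And>j. - 1 \<le> j \<Longrightarrow> V j \<in> P \<rightarrow>\<^sub>M N" "\<And>j. - 1 \<le> j \<Longrightarrow> V' j \<in> Q \<rightarrow>\<^sub>M N"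
    and eq: "\<And>n. distr P (hist_space N n) (hist V n) = distr Q (hist_space N n) (hist V' n)"
  shows "distr P (Pi\<^sub>M UNIV (\<lambda>_::nat. N)) (\<lambda>\<omega> n. V (int n) \<omega>) =
         distr Q (Pi\<^sub>M UNIV (\<lambda>_::nat. N)) (\<lambda>\<omega> n. V' (int n) \<omega>)"
proof (rule measure_eqI_PiM_infinite)
  have seq: "(\<lambda>\<omega> n. V (int n) \<omega>) \<in> P \<rightarrow>\<^sub>M Pi\<^sub>M UNIV (\<lambda>_::nat. N)"
    if "\<And>j. - 1 \<le> j \<Longrightarrow> V j \<in> P \<rightarrow>\<^sub>M N" for V and P :: "'x measure"
    by (rule measurable_PiM_single') (use that in \<open>auto intro: measurable_space[OF that]\<close>)
  show "finite_measure (distr P (Pi\<^sub>M UNIV (\<lambda>_::nat. N)) (\<lambda>\<omega> n. V (int n) \<omega>))"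
    by (rule finite_measure.finite_measure_distr[OF P]) (rule seq[OF V(1)])
  fix J :: "nat set" and A assume J: "finite J" and A: "\<And>i. i \<in> J \<Longrightarrow> A i \<in> sets N"
  obtain n where n: "J \<subseteq> {..<n}" using finite_nat_iff_bounded J by auto
  \<comment> \<open>The cylinder over \<open>J\<close>, rewritten as an event of the history up to
    \<open>n\<close>.\<close>
  let ?B = "{v \<in> space (hist_space N n). \<forall>i\<in>J. v (int i) \<in> A i}"
  have B: "?B \<in> sets (hist_space N n)"
  proof (rule sets.sets_Collect_finite_All[OF _ J])
    fix i assume "i \<in> J"
    then have "int i \<in> {-1..<int n}" using n by auto
    then show "{v \<in> space (hist_space N n). v (int i) \<in> A i} \<in> sets (hist_space N n)"
      using measurable_sets[OF measurable_component_singleton[of "int i" "{-1..<int n}" "\<lambda>_. N"] A]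
        \<open>i \<in> J\<close> by (simp add: vimage_def Int_def conj_commute)
  qed
  have C: "prod_emb UNIV (\<lambda>_. N) J (Pi\<^sub>E J A) \<in> sets (Pi\<^sub>M UNIV (\<lambda>_::nat. N))"
    using J A by (intro sets_PiM_I) auto
  have *: "emeasure (distr P (Pi\<^sub>M UNIV (\<lambda>_::nat. N)) (\<lambda>\<omega> n. V (int n) \<omega>))
        (prod_emb UNIV (\<lambda>_. N) J (Pi\<^sub>E J A)) = emeasure (distr P (hist_space N n) (hist V n)) ?B"
    if V: "\<And>j. - 1 \<le> j \<Longrightarrow> V j \<in> P \<rightarrow>\<^sub>M N" for V and P :: "'x measure"
  proof -
    have "(\<lambda>\<omega> n. V (int n) \<omega>) -` prod_emb UNIV (\<lambda>_. N) J (Pi\<^sub>E J A) \<inter> space P =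
        hist V n -` ?B \<inter> space P"
      using n measurable_space[OF V] measurable_space[OF measurable_hist[OF V]]
      by (auto simp: prod_emb_def hist_def PiE_iff subset_iff space_PiM)
    then show ?thesis
      using emeasure_distr[OF seq[of V P, OF V] C] emeasure_distr[OF measurable_hist[of V P, OF V] B]
      by simp
  qed
  show "emeasure (distr P (Pi\<^sub>M UNIV (\<lambda>_::nat. N)) (\<lambda>\<omega> n. V (int n) \<omega>))
        (prod_emb UNIV (\<lambda>_. N) J (Pi\<^sub>E J A)) =
      emeasure (distr Q (Pi\<^sub>M UNIV (\<lambda>_::nat. N)) (\<lambda>\<omega> n. V' (int n) \<omega>))
        (prod_emb UNIV (\<lambda>_. N) J (Pi\<^sub>E J A))"
    using *[of V P, OF V(1)] *[of V' Q, OF V(2)] eq by simp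
qed simp_all

section \<open>From conditional expectations to integral identities\<close>

text \<open>A conditional expectation and the variable itself have the same integral over every
  event of the conditioning \<sigma>-algebra. Finiteness of the kernel values permits passing from
  \<open>measure\<close> to \<open>emeasure\<close>.\<close>

lemma has_cond_law_emeasure:
  assumes "prob_space P" and law: "has_cond_law P F M X \<kappa>"
    and A: "A \<in> sets M" and G: "G \<in> sets F"
    and fin: "\<And>\<omega>. \<omega> \<in> space P \<Longrightarrow> finite_measure (\<kappa> \<omega>)"
    and meas: "(\<lambda>\<omega>. emeasure (\<kappa> \<omega>) A) \<in> borel_measurable P"
  shows "emeasure P {\<omega>\<in>space P. \<omega> \<in> G \<and> X \<omega> \<in> A} = (\<integral>\<^sup>+\<omega>. indicator G \<omega> * emeasure (\<kappa> \<omega>) A \<partial>P)"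
proof -
  interpret prob_space P by fact
  have X: "X \<in> P \<rightarrow>\<^sub>M M" and F: "subalgebra P F"
    and AE: "AE \<omega> in P. real_cond_exp P F (indicator (X -` A \<inter> space P)) \<omega> = measure (\<kappa> \<omega>) A"
    using law A by (auto simp: has_cond_law_def)
  interpret finite_measure_subalgebra P F
    by unfold_locales (fact F)
  have G'[measurable]: "G \<in> sets P" using G F by (auto simp: subalgebra_def)
  have XA[measurable]: "X -` A \<inter> space P \<in> sets P" using X A by (rule measurable_sets)
  let ?I = "indicator (X -` A \<inter> space P) :: _ \<Rightarrow> real"
  have int: "integrable P ?I" by (simp add: emeasure_eq_measure)
  have k[measurable]: "(\<lambda>\<omega>. measure (\<kappa> \<omega>) A) \<in> borel_measurable P"
    unfolding measure_def using meas by measurable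
  \<comment> \<open>No uniform bound on the kernel is given; integrability is inherited from the
    conditional expectation, which agrees with it almost surely.\<close>
  have kint: "integrable P (\<lambda>\<omega>. measure (\<kappa> \<omega>) A)"
    using real_cond_exp_int(1)[OF int] AE by (subst integrable_cong_AE[symmetric]) auto
  have "emeasure P {\<omega>\<in>space P. \<omega> \<in> G \<and> X \<omega> \<in> A} = ennreal (\<integral>\<omega>\<in>G. ?I \<omega> \<partial>P)"
  proof -
    have "(\<integral>\<omega>\<in>G. ?I \<omega> \<partial>P) = (\<integral>\<omega>. indicator {\<omega>\<in>space P. \<omega> \<in> G \<and> X \<omega> \<in> A} \<omega> \<partial>P)"
      unfolding set_lebesgue_integral_def
      by (rule Bochner_Integration.integral_cong) (auto simp: indicator_def)
    moreover have "{\<omega>\<in>space P. \<omega> \<in> G \<and> X \<omega> \<in> A} \<subseteq> space P" by auto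
    ultimately show ?thesis by (simp add: emeasure_eq_measure Int_absorb2)
  qed
  also have "(\<integral>\<omega>\<in>G. ?I \<omega> \<partial>P) = (\<integral>\<omega>\<in>G. real_cond_exp P F ?I \<omega> \<partial>P)"
    by (rule real_cond_exp_intA[OF int G])
  also have "\<dots> = (\<integral>\<omega>. indicator G \<omega> * measure (\<kappa> \<omega>) A \<partial>P)"
    unfolding set_lebesgue_integral_def by (rule integral_cong_AE) (use AE in auto)
  also have "ennreal \<dots> = (\<integral>\<^sup>+\<omega>. ennreal (indicator G \<omega> * measure (\<kappa> \<omega>) A) \<partial>P)"
    using integrable_mult_indicator[OF G' kint]
    by (intro nn_integral_eq_integral[symmetric]) auto
  also have "\<dots> = (\<integral>\<^sup>+\<omega>. indicator G \<omega> * emeasure (\<kappa> \<omega>) A \<partial>P)"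
    by (rule nn_integral_cong)
       (auto simp: indicator_def finite_measure.emeasure_eq_measure[OF fin])
  finally show ?thesis .
qed


section \<open>The urn as a mixture chain\<close>

lemma emeasure_distr_Some_vimage:
  assumes "sets L = sets M" "A \<in> sets (hat_space M)"
  shows "emeasure (distr L (hat_space M) Some) A = emeasure L (Some -` A)"
proof -
  have "Some \<in> L \<rightarrow>\<^sub>M hat_space M"
    using measurable_Some_hat_space[of M] measurable_cong_sets[OF assms(1) refl] by blast
  moreover have "Some -` A \<in> sets M"
    using assms(2) by (auto simp: sets_hat_space Some_vimage_image Some_vimage_insert)
  ultimately show ?thesis
    using assms sets.sets_into_space[of "Some -` A" L] by (simp add: emeasure_distr Int_absorb2)
qed

text \<open>Unrolling the recursion, \<open>U n\<close> is \<open>U0\<close> plus the kernels at the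
  earlier draws. Since the extended kernel at \<Delta> is \<open>U0\<close>, prepending \<Delta> at
  time -1 turns this into a uniform sum over the history.\<close>

lemma mixture_chain_urn:
  fixes Z :: "nat \<Rightarrow> 'w \<Rightarrow> 'a"
  defines "V \<equiv> \<lambda>j \<omega>. if j < 0 then None else Some (Z (nat j) \<omega>)"
  assumes R: "markov_kernel M R" and U0: "prob_space U0" "sets U0 = sets M"
    and urn: "urn_model P M R U0 U Z"
  shows "mixture_chain P (hat_space M) (hat_kernel M U0 R) V"
    and "\<And>j. V j \<in> P \<rightarrow>\<^sub>M hat_space M"
proof -
  let ?N = "hat_space M" and ?K = "hat_kernel M U0 R"
  have P: "prob_space P"
    and law: "has_cond_law P (past_draws P M Z n) M (Z n)
        (\<lambda>\<omega>. scale_measure (ennreal (1 / (real n + 1))) (U n \<omega>))" for n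
    using urn by (auto simp: urn_model_def)
  have Z[measurable]: "Z n \<in> P \<rightarrow>\<^sub>M M" for n
    using law by (auto simp: has_cond_law_def)
  show V: "V j \<in> P \<rightarrow>\<^sub>M ?N" for j
    unfolding V_def by (cases "j < 0") (auto simp: space_hat_space)
  have K: "?K \<in> ?N \<rightarrow>\<^sub>M prob_algebra ?N"
    using markov_kernel_hat_kernel[OF U0 R] by (simp add: markov_kernel_iff_prob_algebra)
  \<comment> \<open>For \<open>n = 0\<close> the only term, at index -1, is the extended kernel at
    \<open>None\<close>, which is \<open>U0\<close>. Each draw then adds the term of index
    \<open>int n\<close>.\<close>
  have U: "emeasure (U n \<omega>) (Some -` A) = (\<Sum>j\<in>{-1..<int n}. emeasure (?K (V j \<omega>)) A)"
    if \<omega>: "\<omega> \<in> space P" and A: "A \<in> sets ?N" for n \<omega> A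
  proof (induction n)
    case 0
    have I: "{-1..<int 0} = {-1}" by auto
    show ?case
      unfolding I using urn \<omega> A U0
      by (simp add: V_def hat_kernel_def emeasure_distr_Some_vimage urn_model_def)
  next
    case (Suc n)
    have I: "{-1..<int (Suc n)} = insert (int n) {-1..<int n}" by auto
    have "Some -` A \<in> sets M"
      using A by (auto simp: sets_hat_space Some_vimage_image Some_vimage_insert)
    moreover have "sets (R (Z n \<omega>)) = sets M"
      using R measurable_space[OF Z \<omega>] by (auto simp: markov_kernel_def)
    ultimately show ?case
      unfolding I using urn \<omega> A Suc
      by (simp add: V_def hat_kernel_def emeasure_distr_Some_vimage urn_model_def add.commute)
  qed
  show "mixture_chain P ?N ?K V"
    unfolding mixture_chain_def
  proof (intro allI ballI)
    fix n E A assume E: "E \<in> sets (hist_space ?N n)" and A: "A \<in> sets ?N"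
    let ?F = "past_draws P M Z n" and ?G = "{\<omega> \<in> space P. hist V n \<omega> \<in> E}"
    have sF: "space ?F = space P" by (simp add: past_draws_def)
    have ZF: "Z k \<in> ?F \<rightarrow>\<^sub>M M" if "k < n" for k
    proof -
      have "(\<lambda>\<omega>. \<lambda>k\<in>{..<n}. Z k \<omega>) \<in> ?F \<rightarrow>\<^sub>M Pi\<^sub>M {..<n} (\<lambda>_. M)"
        unfolding past_draws_def
        by (intro measurable_vimage_algebra1 Pi_I) (simp add: space_PiM PiE_iff measurable_space[OF Z])
      from measurable_compose[OF this measurable_component_singleton[of k]] that
      show ?thesis by simp
    qed
    \<comment> \<open>Each entry of the history is either constant or \<open>Some\<close> of a draw
      before time \<open>n\<close>, so events of the history lie in the \<sigma>-algebra of the past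
      draws.\<close>
    have "hist V n \<in> ?F \<rightarrow>\<^sub>M hist_space ?N n"
      unfolding hist_def
    proof (rule measurable_restrict)
      fix j assume "j \<in> {-1..<int n}"
      then show "V j \<in> ?F \<rightarrow>\<^sub>M ?N"
        unfolding V_def using measurable_compose[OF ZF[of "nat j"] measurable_Some_hat_space]
        by (cases "j < 0") (auto simp: space_hat_space)
    qed
    from measurable_sets[OF this E] have G: "?G \<in> sets ?F"
      by (simp add: sF vimage_def Int_def conj_commute)
    have SA: "Some -` A \<in> sets M"
      using A by (auto simp: sets_hat_space Some_vimage_image Some_vimage_insert)
    have eq: "emeasure (scale_measure (ennreal (1 / (real n + 1))) (U n \<omega>)) (Some -` A) =
        mixture ?K n A (hist V n \<omega>)" if "\<omega> \<in> space P" for \<omega>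
      using U[OF that A] by (simp add: mixture_def hist_nth)
    have "emeasure P {\<omega>\<in>space P. hist V n \<omega> \<in> E \<and> V (int n) \<omega> \<in> A} =
        emeasure P {\<omega>\<in>space P. \<omega> \<in> ?G \<and> Z n \<omega> \<in> Some -` A}"
      by (rule arg_cong[where f="emeasure P"]) (auto simp: V_def)
    also have "\<dots> = (\<integral>\<^sup>+\<omega>. indicator ?G \<omega> *
        emeasure (scale_measure (ennreal (1 / (real n + 1))) (U n \<omega>)) (Some -` A) \<partial>P)"
    proof (rule has_cond_law_emeasure[OF P law SA G])
      fix \<omega> assume \<omega>: "\<omega> \<in> space P"
      have "space (U n \<omega>) = space M"
        using urn \<omega> by (intro sets_eq_imp_space_eq) (simp add: urn_model_def)
      with urn_model_total_mass[OF R U0 urn \<omega>, of n]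
      show "finite_measure (scale_measure (ennreal (1 / (real n + 1))) (U n \<omega>))"
        by (intro finite_measureI)
           (simp del: of_nat_add of_nat_Suc add: space_scale_measure ennreal_mult_eq_top_iff)
    next
      \<comment> \<open>Measurability of the random composition comes from \<open>eq\<close>, which
        makes its mass a measurable function of the history.\<close>
      show "(\<lambda>\<omega>. emeasure (scale_measure (ennreal (1 / (real n + 1))) (U n \<omega>)) (Some -` A))
          \<in> borel_measurable P"
        using measurable_compose[OF measurable_hist[OF V] measurable_mixture[OF K A]]
        by (rule measurable_cong[THEN iffD2, rotated]) (rule eq)
    qed
    also have "\<dots> = (\<integral>\<^sup>+\<omega>. indicator E (hist V n \<omega>) * mixture ?K n A (hist V n \<omega>) \<partial>P)"
      by (rule nn_integral_cong) (auto simp: eq indicator_def simp del: emeasure_scale_measure)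
    finally show "emeasure P {\<omega>\<in>space P. hist V n \<omega> \<in> E \<and> V (int n) \<omega> \<in> A} =
        (\<integral>\<^sup>+\<omega>. indicator E (hist V n \<omega>) * mixture ?K n A (hist V n \<omega>) \<partial>P)" .
  qed
qed

section \<open>The branching chain as a mixture chain\<close>

locale tree_chain = prob_space Q
  for Q :: "'v measure" +
  fixes N :: "'b measure" and K :: "'b \<Rightarrow> 'b measure" and x0 :: 'b
    and D :: "nat \<Rightarrow> 'v \<Rightarrow> int" and W :: "int \<Rightarrow> 'v \<Rightarrow> 'b"
  assumes K: "K \<in> N \<rightarrow>\<^sub>M prob_algebra N" and x0: "x0 \<in> space N"
    and tree: "random_recursive_tree Q D"
    and chain: "branching_markov_chain Q N K x0 D W"
begin

abbreviation parents_space :: "nat \<Rightarrow> (nat \<Rightarrow> int) measure" where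
  "parents_space n \<equiv> Pi\<^sub>M {..<n} (\<lambda>k. count_space {-1..<int k})"

text \<open>These are the parents of the vertices below \<open>n\<close>, which determine the tree
  just before vertex \<open>n\<close> is attached. Leaving out \<open>D n\<close> is what makes
  independence from \<open>D n\<close> possible.\<close>

definition parents :: "nat \<Rightarrow> 'v \<Rightarrow> nat \<Rightarrow> int" where
  "parents n \<omega> = (\<lambda>k\<in>{..<n}. D k \<omega>)"

lemma measurable_parent: "D n \<in> Q \<rightarrow>\<^sub>M count_space {-1..<int n}"
  using tree by (auto simp: random_recursive_tree_def indep_vars_def)

lemma parent_range: "\<omega> \<in> space Q \<Longrightarrow> D n \<omega> \<in> {-1..<int n}"
  using measurable_space[OF measurable_parent] by auto

lemma parent_event: "j \<in> {-1..<int n} \<Longrightarrow> {\<omega>\<in>space Q. D n \<omega> = j} \<in> sets Q"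
  using measurable_sets[OF measurable_parent[of n], of "{j}"]
  by (simp add: vimage_def Int_def conj_commute)

lemma measurable_position: "- 1 \<le> j \<Longrightarrow> W j \<in> Q \<rightarrow>\<^sub>M N"
proof (cases "j = -1")
  case True
  have "W (-1) \<in> Q \<rightarrow>\<^sub>M N \<longleftrightarrow> (\<lambda>_. x0) \<in> Q \<rightarrow>\<^sub>M N"
    by (rule measurable_cong) (use chain in \<open>auto simp: branching_markov_chain_def\<close>)
  then show ?thesis using True x0 by simp
next
  case False
  moreover assume "-1 \<le> j"
  ultimately have "j = int (nat j)" by simp
  then show ?thesis using chain unfolding branching_markov_chain_def has_cond_law_def by metis
qed

lemma measurable_parents: "parents n \<in> Q \<rightarrow>\<^sub>M parents_space n"
  unfolding parents_def by (rule measurable_restrict) (rule measurable_parent)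

text \<open>The index \<open>k\<close> is not tied to \<open>m\<close>: the conditioning includes
  the whole tree, so even parents of later vertices are known. This is used for \<open>D n\<close>
  with \<open>n\<close> beyond \<open>m\<close>.\<close>

lemma measurable_tree_and_past:
  shows "D k \<in> tree_and_past Q N D W m \<rightarrow>\<^sub>M count_space {-1..<int k}"
    and "hist W m \<in> tree_and_past Q N D W m \<rightarrow>\<^sub>M hist_space N m"
proof -
  have *: "(\<lambda>\<omega>. (\<lambda>k. D k \<omega>, \<lambda>j\<in>{-1..<int m}. W j \<omega>)) \<in> tree_and_past Q N D W m \<rightarrow>\<^sub>M
      Pi\<^sub>M UNIV (\<lambda>k. count_space {-1..<int k}) \<Otimes>\<^sub>M hist_space N m"
    unfolding tree_and_past_def
    by (rule measurable_vimage_algebra1)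
       (use parent_range in \<open>auto simp: space_PiM space_pair_measure
          intro: measurable_space[OF measurable_position]\<close>)
  show "D k \<in> tree_and_past Q N D W m \<rightarrow>\<^sub>M count_space {-1..<int k}"
    using measurable_compose[OF measurable_compose[OF * measurable_fst]
        measurable_component_singleton[of k]] by simp
  show "hist W m \<in> tree_and_past Q N D W m \<rightarrow>\<^sub>M hist_space N m"
    using measurable_compose[OF * measurable_snd] by (simp add: hist_def[abs_def])
qed

lemma space_tree_and_past: "space (tree_and_past Q N D W m) = space Q"
  by (simp add: tree_and_past_def)

text \<open>The random index \<open>D m\<close> takes finitely many values, and for each fixed value
  the position is measurable.\<close>

lemma measurable_parent_position: "(\<lambda>\<omega>. W (D m \<omega>) \<omega>) \<in> Q \<rightarrow>\<^sub>M N"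
  by (rule measurable_compose_countable'[OF _ measurable_parent])
     (auto intro: measurable_position)

lemma emeasure_next_position:
  assumes A: "A \<in> sets N" and G: "G \<in> sets (tree_and_past Q N D W m)"
  shows "emeasure Q {\<omega>\<in>space Q. \<omega> \<in> G \<and> W (int m) \<omega> \<in> A} =
    (\<integral>\<^sup>+\<omega>. indicator G \<omega> * emeasure (K (W (D m \<omega>) \<omega>)) A \<partial>Q)"
proof (rule has_cond_law_emeasure[OF prob_space_axioms _ A G])
  show "has_cond_law Q (tree_and_past Q N D W m) N (W (int m)) (\<lambda>\<omega>. K (W (D m \<omega>) \<omega>))"
    using chain by (simp add: branching_markov_chain_def)
  show "(\<lambda>\<omega>. emeasure (K (W (D m \<omega>) \<omega>)) A) \<in> borel_measurable Q"
    by (rule measurable_compose[OF measurable_parent_position measurable_emeasure_prob_kernel[OF K A]])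
  show "finite_measure (K (W (D m \<omega>) \<omega>))" if "\<omega> \<in> space Q" for \<omega>
    using measurable_space[OF K measurable_space[OF measurable_parent_position that, of m]]
    by (simp add: space_prob_algebra prob_space_def)
qed

lemma prob_parent:
  assumes "j \<in> {-1..<int n}"
  shows "prob {\<omega>\<in>space Q. D n \<omega> = j} = 1 / (real n + 1)"
proof -
  have "prob {\<omega>\<in>space Q. D n \<omega> = j} = measure (distr Q (count_space {-1..<int n}) (D n)) {j}"
    using assms measurable_parent
    by (subst measure_distr) (auto intro!: arg_cong[where f=prob])
  also have "\<dots> = measure (uniform_count_measure {-1..<int n}) {j}"
    using tree by (simp add: random_recursive_tree_def)
  also have "\<dots> = 1 / (real n + 1)"
    using assms by (subst measure_uniform_count_measure) auto
  finally show ?thesis .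
qed

text \<open>Independent variables stay independent when grouped over disjoint index sets, here
  \<open>{..<n}\<close> and \<open>{n}\<close>; the uniform law of \<open>D n\<close> supplies the
  factor.\<close>

lemma parents_indep_parent:
  assumes j: "j \<in> {-1..<int n}" and C: "C \<in> sets (parents_space n)"
  shows "emeasure Q {\<omega>\<in>space Q. parents n \<omega> \<in> C \<and> D n \<omega> = j} =
    ennreal (1 / (real n + 1)) * emeasure Q {\<omega>\<in>space Q. parents n \<omega> \<in> C}"
proof -
  have "indep_vars (\<lambda>n. count_space {-1..<int n}) D UNIV"
    using tree by (simp add: random_recursive_tree_def)
  then have ind: "indep_var (parents_space n) (\<lambda>\<omega>. restrict (\<lambda>i. D i \<omega>) {..<n})
      (Pi\<^sub>M {n} (\<lambda>k. count_space {-1..<int k})) (\<lambda>\<omega>. restrict (\<lambda>i. D i \<omega>) {n})"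
    by (rule indep_var_restrict) auto
  \<comment> \<open>The grouped variable over \<open>{n}\<close> is a function on a singleton, so
    the event that \<open>D n\<close> equals \<open>j\<close> has to be written as a box.\<close>
  have J: "(\<Pi>\<^sub>E k\<in>{n}. {j}) \<in> sets (Pi\<^sub>M {n} (\<lambda>k. count_space {-1..<int k}))"
    using j by (intro sets_PiM_I_finite) auto
  have "prob ((\<lambda>\<omega>. (\<lambda>i\<in>{..<n}. D i \<omega>, \<lambda>i\<in>{n}. D i \<omega>)) -` (C \<times> (\<Pi>\<^sub>E k\<in>{n}. {j})) \<inter> space Q) =
      prob ((\<lambda>\<omega>. \<lambda>i\<in>{..<n}. D i \<omega>) -` C \<inter> space Q) *
      prob ((\<lambda>\<omega>. \<lambda>i\<in>{n}. D i \<omega>) -` (\<Pi>\<^sub>E k\<in>{n}. {j}) \<inter> space Q)"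
    by (rule indep_varD[OF ind C J])
  moreover have n: "(\<lambda>i\<in>{n}. D i \<omega>) \<in> (\<Pi>\<^sub>E k\<in>{n}. {j}) \<longleftrightarrow> D n \<omega> = j" for \<omega>
    unfolding PiE_iff by simp
  have "(\<lambda>\<omega>. (\<lambda>i\<in>{..<n}. D i \<omega>, \<lambda>i\<in>{n}. D i \<omega>)) -` (C \<times> (\<Pi>\<^sub>E k\<in>{n}. {j})) \<inter> space Q =
      {\<omega>\<in>space Q. parents n \<omega> \<in> C \<and> D n \<omega> = j}"
    unfolding vimage_def mem_Times_iff fst_conv snd_conv n by (auto simp: parents_def)
  moreover have "(\<lambda>\<omega>. \<lambda>i\<in>{..<n}. D i \<omega>) -` C \<inter> space Q = {\<omega>\<in>space Q. parents n \<omega> \<in> C}"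
    by (auto simp: parents_def)
  moreover have "(\<lambda>\<omega>. \<lambda>i\<in>{n}. D i \<omega>) -` (\<Pi>\<^sub>E k\<in>{n}. {j}) \<inter> space Q = {\<omega>\<in>space Q. D n \<omega> = j}"
    unfolding vimage_def n by auto
  ultimately show ?thesis
    by (simp add: prob_parent[OF j] emeasure_eq_measure mult.commute flip: ennreal_mult)
qed


text \<open>This is the predictive law of the chain given the tree, as a function of parents and
  history. The condition \<open>m < n\<close> ensures that the parent of \<open>m\<close> is among
  the recorded coordinates.\<close>

lemma measurable_kernel_at_parent:
  assumes A: "A \<in> sets N" and "m < n"
  shows "(\<lambda>y. emeasure (K (snd y (fst y m))) A) \<in> borel_measurable (parents_space n \<Otimes>\<^sub>M hist_space N m)"
proof (rule measurable_compose[OF _ measurable_emeasure_prob_kernel[OF K A]])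
  have "(\<lambda>y. fst y m) \<in> parents_space n \<Otimes>\<^sub>M hist_space N m \<rightarrow>\<^sub>M count_space {-1..<int m}"
    using measurable_compose[OF measurable_fst
        measurable_component_singleton[of m "{..<n}" "\<lambda>k. count_space {-1..<int k}"]] assms by simp
  then show "(\<lambda>y. snd y (fst y m)) \<in> parents_space n \<Otimes>\<^sub>M hist_space N m \<rightarrow>\<^sub>M N"
  proof (rule measurable_compose_countable'[rotated])
    fix i assume "i \<in> {-1..<int m}"
    from measurable_compose[OF measurable_snd measurable_component_singleton[OF this]]
    show "(\<lambda>y. snd y i) \<in> parents_space n \<Otimes>\<^sub>M hist_space N m \<rightarrow>\<^sub>M N" .
  qed simp
qed

text \<open>
  Independence of \<open>D n\<close> from the values before time \<open>m \<le> n\<close> is not assumed. It is carried along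
  the construction jointly with the earlier parents, since the next value depends on them.
\<close>

lemma parents_hist_indep_parent:
  assumes j: "j \<in> {-1..<int n}" and "m \<le> n"
  shows "distr (density Q (indicator {\<omega>\<in>space Q. D n \<omega> = j})) (parents_space n \<Otimes>\<^sub>M hist_space N m)
      (\<lambda>\<omega>. (parents n \<omega>, hist W m \<omega>)) =
    distr (density Q (\<lambda>_. ennreal (1 / (real n + 1)))) (parents_space n \<Otimes>\<^sub>M hist_space N m)
      (\<lambda>\<omega>. (parents n \<omega>, hist W m \<omega>))"
  using \<open>m \<le> n\<close>
proof (induction m)
  case 0
  let ?S = "{\<omega>\<in>space Q. D n \<omega> = j}" and ?q = "ennreal (1 / (real n + 1))"
  note [measurable] = measurable_parents
  note S[measurable] = parent_event[OF j]
  let ?c = "\<lambda>j\<in>{-1..<int 0}. x0"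
  have I: "{-1..<int 0} = {-1}" by auto
  have c: "?c \<in> space (hist_space N 0)" using x0 by (auto simp: space_PiM)
  have h: "hist W 0 \<omega> = ?c" if "\<omega> \<in> space Q" for \<omega>
    using that chain by (simp only: hist_def I) (auto simp: branching_markov_chain_def)
  \<comment> \<open>One density restricts \<open>Q\<close> to the event that \<open>D n\<close>
    equals \<open>j\<close>, the other scales \<open>Q\<close> by the probability of that event.
    Equality of the image measures therefore expresses independence from that event.\<close>
  have eq: "distr (density Q (indicator ?S)) (parents_space n) (parents n) =
      distr (density Q (\<lambda>_. ?q)) (parents_space n) (parents n)"
  proof (rule measure_eqI)
    fix C assume "C \<in> sets (distr (density Q (indicator ?S)) (parents_space n) (parents n))"
    then have C[measurable]: "C \<in> sets (parents_space n)" by simp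
    have "emeasure (distr (density Q (indicator ?S)) (parents_space n) (parents n)) C =
        emeasure Q (?S \<inter> (parents n -` C \<inter> space Q))"
      by (simp add: emeasure_distr emeasure_density nn_integral_indicator
          flip: indicator_inter_arith)
    also have "\<dots> = emeasure Q {\<omega>\<in>space Q. parents n \<omega> \<in> C \<and> D n \<omega> = j}"
      by (rule arg_cong[where f="emeasure Q"]) auto
    also have "\<dots> = ?q * emeasure Q {\<omega>\<in>space Q. parents n \<omega> \<in> C}"
      by (rule parents_indep_parent[OF j C])
    also have "{\<omega>\<in>space Q. parents n \<omega> \<in> C} = parents n -` C \<inter> space Q" by auto
    also have "?q * emeasure Q \<dots> =
        emeasure (distr (density Q (\<lambda>_. ?q)) (parents_space n) (parents n)) C"
      by (simp add: emeasure_distr emeasure_density nn_integral_cmult_indicator)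
    finally show "emeasure (distr (density Q (indicator ?S)) (parents_space n) (parents n)) C =
        emeasure (distr (density Q (\<lambda>_. ?q)) (parents_space n) (parents n)) C" .
  qed simp
  \<comment> \<open>The initial history is the constant \<open>?c\<close>, so the pair is an image
    of the parents alone, under either density.\<close>
  have *: "distr (density Q f) (parents_space n \<Otimes>\<^sub>M hist_space N 0) (\<lambda>\<omega>. (parents n \<omega>, hist W 0 \<omega>)) =
      distr (distr (density Q f) (parents_space n) (parents n))
        (parents_space n \<Otimes>\<^sub>M hist_space N 0) (\<lambda>d. (d, ?c))" for f
  proof -
    have "(\<lambda>d. (d, ?c)) \<in> parents_space n \<rightarrow>\<^sub>M parents_space n \<Otimes>\<^sub>M hist_space N 0"
      using c by (intro measurable_Pair measurable_ident measurable_const) auto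
    then have "distr (distr (density Q f) (parents_space n) (parents n))
        (parents_space n \<Otimes>\<^sub>M hist_space N 0) (\<lambda>d. (d, ?c)) =
        distr (density Q f) (parents_space n \<Otimes>\<^sub>M hist_space N 0) ((\<lambda>d. (d, ?c)) \<circ> parents n)"
      by (rule distr_distr) measurable
    also have "\<dots> = distr (density Q f) (parents_space n \<Otimes>\<^sub>M hist_space N 0)
        (\<lambda>\<omega>. (parents n \<omega>, hist W 0 \<omega>))"
      by (rule distr_cong) (simp_all only: space_density comp_apply h)
    finally show ?thesis ..
  qed
  show ?case unfolding * eq ..
next
  case (Suc m)
  let ?S = "{\<omega>\<in>space Q. D n \<omega> = j}" and ?q = "ennreal (1 / (real n + 1))"
  let ?T = "parents_space n" and ?L = "parents_space n \<Otimes>\<^sub>M hist_space N m"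
  let ?F = "tree_and_past Q N D W m"
  let ?Y = "\<lambda>\<omega>. (parents n \<omega>, hist W m \<omega>)"
  let ?k = "\<lambda>A y. emeasure (K (snd y (fst y m))) A"
  note [measurable] = measurable_parents measurable_hist[of W, OF measurable_position]
    measurable_position[of "int m", simplified]
  have "m < n" using Suc by simp
  \<comment> \<open>Vertex \<open>n\<close> comes after \<open>m\<close>, but its parent belongs to
    the tree being conditioned on. Restricting to this event thus leaves the predictive law of the
    next position unchanged.\<close>
  have SF: "?S \<in> sets ?F"
    using measurable_sets[OF measurable_tree_and_past(1)[of n m], of "{j}"] j
    by (simp add: vimage_def Int_def conj_commute space_tree_and_past)
  note S[measurable] = parent_event[OF j]
  have YF: "?Y \<in> ?F \<rightarrow>\<^sub>M ?L"
    unfolding parents_def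
    by (intro measurable_Pair measurable_restrict measurable_tree_and_past)
  have k[measurable]: "?k A \<in> borel_measurable ?L" if "A \<in> sets N" for A
    by (rule measurable_kernel_at_parent[OF that \<open>m < n\<close>])
  \<comment> \<open>The event of the pair \<open>?Y\<close> is absorbed into the conditioning event.
    On the sample space, \<open>?k A\<close> at \<open>?Y\<close> is the kernel at the position of
    the parent of \<open>m\<close>, because both are recorded in \<open>?Y\<close>.\<close>
  have law: "emeasure Q {\<omega>\<in>space Q. \<omega> \<in> G \<and> ?Y \<omega> \<in> E \<and> W (int m) \<omega> \<in> A} =
      (\<integral>\<^sup>+\<omega>. indicator G \<omega> * (indicator E (?Y \<omega>) * ?k A (?Y \<omega>)) \<partial>Q)"
    if G: "G \<in> sets ?F" and E: "E \<in> sets ?L" and A: "A \<in> sets N" for G E A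
  proof -
    have "G \<inter> (?Y -` E \<inter> space Q) \<in> sets ?F"
      using G measurable_sets[OF YF E] by (auto simp: space_tree_and_past)
    note emeasure_next_position[OF A this]
    also have "(\<integral>\<^sup>+\<omega>. indicator (G \<inter> (?Y -` E \<inter> space Q)) \<omega> * emeasure (K (W (D m \<omega>) \<omega>)) A \<partial>Q) =
        (\<integral>\<^sup>+\<omega>. indicator G \<omega> * (indicator E (?Y \<omega>) * ?k A (?Y \<omega>)) \<partial>Q)"
      using parent_range[of _ m] \<open>m < n\<close>
      by (intro nn_integral_cong) (auto simp: indicator_def parents_def hist_def)
    finally show ?thesis
      by (auto elim!: trans[rotated] intro!: arg_cong[where f="emeasure Q"])
  qed
  \<comment> \<open>Under both measures the next position has the same predictive law
    \<open>?k\<close>, so the equality of laws extends by one coordinate.\<close>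
  have ext: "distr (density Q (indicator ?S)) (?L \<Otimes>\<^sub>M N) (\<lambda>\<omega>. (?Y \<omega>, W (int m) \<omega>)) =
      distr (density Q (\<lambda>_. ?q)) (?L \<Otimes>\<^sub>M N) (\<lambda>\<omega>. (?Y \<omega>, W (int m) \<omega>))"
  proof (rule distr_extend_eq[where k="?k"])
    show "finite_measure (density Q (indicator ?S))"
      by (rule finite_measureI) (simp add: emeasure_density emeasure_eq_measure flip: indicator_inter_arith)
  next
    fix E A assume E[measurable]: "E \<in> sets ?L" and A[measurable]: "A \<in> sets N"
    have B[measurable]: "{\<omega>\<in>space Q. ?Y \<omega> \<in> E \<and> W (int m) \<omega> \<in> A} \<in> sets Q" by measurable
    have kY[measurable]: "(\<lambda>\<omega>. indicator E (?Y \<omega>) * ?k A (?Y \<omega>)) \<in> borel_measurable Q"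
    proof (rule measurable_compose[where f="?Y" and g="\<lambda>y. indicator E y * ?k A y"])
      show "?Y \<in> Q \<rightarrow>\<^sub>M ?L" by measurable
      show "(\<lambda>y. indicator E y * ?k A y) \<in> borel_measurable ?L" using k[OF A] by measurable
    qed
    have "emeasure (density Q (indicator ?S)) {\<omega>\<in>space Q. ?Y \<omega> \<in> E \<and> W (int m) \<omega> \<in> A} =
        emeasure Q {\<omega>\<in>space Q. \<omega> \<in> ?S \<and> ?Y \<omega> \<in> E \<and> W (int m) \<omega> \<in> A}"
      by (subst emeasure_density)
         (auto simp flip: indicator_inter_arith intro!: arg_cong[where f="emeasure Q"])
    also have "\<dots> = (\<integral>\<^sup>+\<omega>. indicator ?S \<omega> * (indicator E (?Y \<omega>) * ?k A (?Y \<omega>)) \<partial>Q)"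
      by (rule law[OF SF E A])
    finally show "emeasure (density Q (indicator ?S))
        {\<omega>\<in>space (density Q (indicator ?S)). ?Y \<omega> \<in> E \<and> W (int m) \<omega> \<in> A} =
        (\<integral>\<^sup>+\<omega>. indicator E (?Y \<omega>) * ?k A (?Y \<omega>) \<partial>density Q (indicator ?S))"
      using kY by (simp add: nn_integral_density)
    \<comment> \<open>For the constant density, \<open>law\<close> is used with the whole space as
      conditioning event and then multiplied by \<open>?q\<close>.\<close>
    have "emeasure Q {\<omega>\<in>space Q. ?Y \<omega> \<in> E \<and> W (int m) \<omega> \<in> A} =
        (\<integral>\<^sup>+\<omega>. indicator (space Q) \<omega> * (indicator E (?Y \<omega>) * ?k A (?Y \<omega>)) \<partial>Q)"
      using law[OF _ E A, of "space Q"] sets.top[of ?F] by (simp add: space_tree_and_past cong: conj_cong)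
    also have "\<dots> = (\<integral>\<^sup>+\<omega>. indicator E (?Y \<omega>) * ?k A (?Y \<omega>) \<partial>Q)"
      by (rule nn_integral_cong) auto
    finally have "?q * emeasure Q {\<omega>\<in>space Q. ?Y \<omega> \<in> E \<and> W (int m) \<omega> \<in> A} =
        (\<integral>\<^sup>+\<omega>. ?q * (indicator E (?Y \<omega>) * ?k A (?Y \<omega>)) \<partial>Q)"
      using kY by (simp add: nn_integral_cmult)
    then show "emeasure (density Q (\<lambda>_. ?q))
        {\<omega>\<in>space (density Q (\<lambda>_. ?q)). ?Y \<omega> \<in> E \<and> W (int m) \<omega> \<in> A} =
        (\<integral>\<^sup>+\<omega>. indicator E (?Y \<omega>) * ?k A (?Y \<omega>) \<partial>density Q (\<lambda>_. ?q))"
      using kY by (simp add: nn_integral_density emeasure_density nn_integral_cmult_indicator)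
  qed (use Suc k in simp_all)
  \<comment> \<open>Moves the new position from the outer pair into the history.\<close>
  let ?u = "\<lambda>x. (fst (fst x), (snd (fst x))(int m := snd x))"
  have u: "?u \<in> ?L \<Otimes>\<^sub>M N \<rightarrow>\<^sub>M ?T \<Otimes>\<^sub>M hist_space N (Suc m)"
  proof (rule measurable_Pair)
    have "(\<lambda>x. (snd (fst x), snd x)) \<in> ?L \<Otimes>\<^sub>M N \<rightarrow>\<^sub>M hist_space N m \<Otimes>\<^sub>M N" by measurable
    from measurable_compose[OF this measurable_hist_update]
    show "(\<lambda>x. (snd (fst x))(int m := snd x)) \<in> ?L \<Otimes>\<^sub>M N \<rightarrow>\<^sub>M hist_space N (Suc m)" by simp
  qed measurable
  have *: "distr (density Q f) (?T \<Otimes>\<^sub>M hist_space N (Suc m)) (\<lambda>\<omega>. (parents n \<omega>, hist W (Suc m) \<omega>)) =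
      distr (distr (density Q f) (?L \<Otimes>\<^sub>M N) (\<lambda>\<omega>. (?Y \<omega>, W (int m) \<omega>)))
        (?T \<Otimes>\<^sub>M hist_space N (Suc m)) ?u" for f
    by (subst distr_distr[OF u]) (simp_all add: comp_def hist_Suc)
  show ?case unfolding * ext ..
qed

text \<open>The joint statement with \<open>m = n\<close>, integrated against a function of the
  history only; the earlier parents have served their purpose in the induction.\<close>

lemma hist_indep_parent:
  assumes j: "j \<in> {-1..<int n}" and f[measurable]: "f \<in> borel_measurable (hist_space N n)"
  shows "(\<integral>\<^sup>+\<omega>. indicator {\<omega>\<in>space Q. D n \<omega> = j} \<omega> * f (hist W n \<omega>) \<partial>Q) =
    ennreal (1 / (real n + 1)) * (\<integral>\<^sup>+\<omega>. f (hist W n \<omega>) \<partial>Q)"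
proof -
  let ?S = "{\<omega>\<in>space Q. D n \<omega> = j}" and ?q = "ennreal (1 / (real n + 1))"
  let ?Y = "\<lambda>\<omega>. (parents n \<omega>, hist W n \<omega>)" and ?L = "parents_space n \<Otimes>\<^sub>M hist_space N n"
  note [measurable] = measurable_parents measurable_hist[of W, OF measurable_position]
  note S[measurable] = parent_event[OF j]
  have "(\<integral>\<^sup>+\<omega>. indicator ?S \<omega> * f (hist W n \<omega>) \<partial>Q) =
      (\<integral>\<^sup>+y. f (snd y) \<partial>distr (density Q (indicator ?S)) ?L ?Y)"
    by (simp add: nn_integral_distr nn_integral_density)
  also have "\<dots> = (\<integral>\<^sup>+y. f (snd y) \<partial>distr (density Q (\<lambda>_. ?q)) ?L ?Y)"
    by (simp add: parents_hist_indep_parent[OF j])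
  also have "\<dots> = ?q * (\<integral>\<^sup>+\<omega>. f (hist W n \<omega>) \<partial>Q)"
    by (simp add: nn_integral_distr nn_integral_density nn_integral_cmult)
  finally show ?thesis .
qed

text \<open>The tree is averaged out by splitting according to the value of \<open>D n\<close>: each
  value has weight \<open>1 / (n + 1)\<close> independently of the history, and the weighted kernels
  add up to the mixture.\<close>

lemma mixture_chain_positions: "mixture_chain Q N K W"
  unfolding mixture_chain_def
proof (intro allI ballI)
  fix n E A assume E[measurable]: "E \<in> sets (hist_space N n)" and A: "A \<in> sets N"
  let ?q = "ennreal (1 / (real n + 1))" and ?J = "{-1..<int n}"
  let ?g = "\<lambda>j v. indicator E v * emeasure (K (v j)) A"
  note [measurable] = measurable_hist[of W, OF measurable_position]
  have g[measurable]: "?g j \<in> borel_measurable (hist_space N n)" if "j \<in> ?J" for j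
    using measurable_compose[OF measurable_component_singleton[OF that] measurable_emeasure_prob_kernel[OF K A]]
    by measurable
  note S[measurable] = parent_event[of _ n]
  have G: "hist W n -` E \<inter> space Q \<in> sets (tree_and_past Q N D W n)"
    using measurable_sets[OF measurable_tree_and_past(2) E] by (simp add: space_tree_and_past)
  have "emeasure Q {\<omega>\<in>space Q. hist W n \<omega> \<in> E \<and> W (int n) \<omega> \<in> A} =
      (\<integral>\<^sup>+\<omega>. indicator (hist W n -` E \<inter> space Q) \<omega> * emeasure (K (W (D n \<omega>) \<omega>)) A \<partial>Q)"
    using emeasure_next_position[OF A G] by (simp cong: conj_cong)
  \<comment> \<open>Exactly one \<open>j\<close> equals the parent of \<open>n\<close>. The sum
    replaces the random index by fixed ones, so each term is an indicator of the parent times a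
    function of the history.\<close>
  also have "\<dots> = (\<integral>\<^sup>+\<omega>. (\<Sum>j\<in>?J. indicator {\<omega>\<in>space Q. D n \<omega> = j} \<omega> * ?g j (hist W n \<omega>)) \<partial>Q)"
  proof (rule nn_integral_cong)
    fix \<omega> assume \<omega>: "\<omega> \<in> space Q"
    have "(\<Sum>j\<in>?J. indicator {\<omega>\<in>space Q. D n \<omega> = j} \<omega> * ?g j (hist W n \<omega>)) =
        (\<Sum>j\<in>?J. if j = D n \<omega> then ?g j (hist W n \<omega>) else 0)"
      using \<omega> by (intro sum.cong) (auto simp: indicator_def)
    also have "\<dots> = ?g (D n \<omega>) (hist W n \<omega>)"
      using parent_range[OF \<omega>] by (simp add: sum.delta)
    also have "\<dots> = indicator (hist W n -` E \<inter> space Q) \<omega> * emeasure (K (W (D n \<omega>) \<omega>)) A"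
      using \<omega> by (simp add: indicator_def hist_nth[OF parent_range[OF \<omega>]])
    finally show "indicator (hist W n -` E \<inter> space Q) \<omega> * emeasure (K (W (D n \<omega>) \<omega>)) A =
        (\<Sum>j\<in>?J. indicator {\<omega>\<in>space Q. D n \<omega> = j} \<omega> * ?g j (hist W n \<omega>))" ..
  qed
  also have "\<dots> = (\<Sum>j\<in>?J. \<integral>\<^sup>+\<omega>. indicator {\<omega>\<in>space Q. D n \<omega> = j} \<omega> * ?g j (hist W n \<omega>) \<partial>Q)"
    by (rule nn_integral_sum) (use g S in measurable)
  also have "\<dots> = (\<Sum>j\<in>?J. ?q * (\<integral>\<^sup>+\<omega>. ?g j (hist W n \<omega>) \<partial>Q))"
    by (intro sum.cong refl hist_indep_parent g)
  also have "\<dots> = (\<Sum>j\<in>?J. \<integral>\<^sup>+\<omega>. ?q * ?g j (hist W n \<omega>) \<partial>Q)"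
    using g by (intro sum.cong refl nn_integral_cmult[symmetric]) measurable
  also have "\<dots> = (\<integral>\<^sup>+\<omega>. (\<Sum>j\<in>?J. ?q * ?g j (hist W n \<omega>)) \<partial>Q)"
    by (rule nn_integral_sum[symmetric]) (use g in measurable)
  also have "\<dots> = (\<integral>\<^sup>+\<omega>. indicator E (hist W n \<omega>) * mixture K n A (hist W n \<omega>) \<partial>Q)"
    by (simp add: mixture_def sum_distrib_left ac_simps)
  finally show "emeasure Q {\<omega>\<in>space Q. hist W n \<omega> \<in> E \<and> W (int n) \<omega> \<in> A} =
      (\<integral>\<^sup>+\<omega>. indicator E (hist W n \<omega>) * mixture K n A (hist W n \<omega>) \<partial>Q)" .
qed

end

theorem theorem2p1:
  fixes M :: "'a measure" and R :: "'a \<Rightarrow> 'a measure" and U0 :: "'a measure"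
    and P :: "'w measure" and U :: "nat \<Rightarrow> 'w \<Rightarrow> 'a measure" and Z :: "nat \<Rightarrow> 'w \<Rightarrow> 'a"
    and Q :: "'v measure" and D :: "nat \<Rightarrow> 'v \<Rightarrow> int" and W :: "int \<Rightarrow> 'v \<Rightarrow> 'a option"
  assumes "markov_kernel M R"
    and "prob_space U0" and "sets U0 = sets M"
    and "urn_model P M R U0 U Z"
    and "random_recursive_tree Q D"
    and "branching_markov_chain Q (hat_space M) (hat_kernel M U0 R) None D W"
  shows "distr P (Pi\<^sub>M UNIV (\<lambda>_::nat. hat_space M)) (\<lambda>\<omega> n. Some (Z n \<omega>)) =
         distr Q (Pi\<^sub>M UNIV (\<lambda>_::nat. hat_space M)) (\<lambda>\<omega> n. W (int n) \<omega>)"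
proof -
  \<comment> \<open>The draws preceded by \<Delta> at time -1, matching the root of the
    tree.\<close>
  let ?V = "\<lambda>j \<omega>. if j < 0 then None else Some (Z (nat j) \<omega>)"
  note urn = mixture_chain_urn[OF assms(1-4)]
  have P: "prob_space P" and Q: "prob_space Q"
    using assms(4,6) by (auto simp: urn_model_def branching_markov_chain_def)
  have K: "hat_kernel M U0 R \<in> hat_space M \<rightarrow>\<^sub>M prob_algebra (hat_space M)"
    using markov_kernel_hat_kernel[OF assms(2,3,1)] by (simp add: markov_kernel_iff_prob_algebra)
  interpret tree_chain Q "hat_space M" "hat_kernel M U0 R" None D W
    using Q K assms(5,6) by (intro tree_chain.intro tree_chain_axioms.intro) (auto simp: space_hat_space)
  have "distr P (hist_space (hat_space M) n) (hist ?V n) = distr Q (hist_space (hat_space M) n) (hist W n)" for n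
  proof (rule mixture_chain_distr_hist_eq[OF K P Q urn(2) measurable_position])
    show "W (-1) \<omega> = None" if "\<omega> \<in> space Q" for \<omega>
      using assms(6) that by (simp add: branching_markov_chain_def)
  qed (simp_all add: urn(1) mixture_chain_positions)
  \<comment> \<open>Only times \<open>int n\<close>, which are nonnegative, enter the sequence, so
    there \<open>?V\<close> reduces to \<open>Some\<close> of the draws.\<close>
  with P have "distr P (Pi\<^sub>M UNIV (\<lambda>_::nat. hat_space M)) (\<lambda>\<omega> n. ?V (int n) \<omega>) =
      distr Q (Pi\<^sub>M UNIV (\<lambda>_::nat. hat_space M)) (\<lambda>\<omega> n. W (int n) \<omega>)"
    by (intro distr_sequence_eqI[OF _ urn(2) measurable_position]) (simp_all add: prob_space_def)
  then show ?thesis by simp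
qed

end
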